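(* Let $A_n$ be the alternating group on $n$ symbols. If $n\geq 18$, then the difference graph $D(A_n)$ is connected.
   Context: For a group $G$, the power graph $\mathsf{Pow}(G)$ has vertex set $G$, with distinct $a,b$ adjacent iff $a\in\langle b\rangle$ or $b\in\langle a\rangle$. The enhanced power graph $\mathsf{EPow}(G)$ has vertex set $G$, with distinct $a,b$ adjacent iff $\langle a,b\rangle$ is cyclic. The difference graph $D(G)$ is the graph $\mathsf{EPow}(G)-\mathsf{Pow}(G)$ with all isolated vertices removed; thus $x\sim y$ in $D(G)$ iff $\langle x,y\rangle$ is cyclic, $x\notin\langle y\rangle$ and $y\notin\langle x\rangle$. *)

theory Defs
  imports
    "HOL-Algebra.Sym_Groups"
    "HOL-Algebra.Elementary_Groups"
    "Graph_Theory.Graph_Theory"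
begin

text \<open>
  A simple undirected graph is represented by a \<^typ>\<open>'a pair_pre_digraph\<close> whose arc
  set is an irreflexive symmetric relation; an edge is a pair of opposite arcs.
\<close>

definition power_graph :: "('a, 'm) monoid_scheme \<Rightarrow> 'a pair_pre_digraph" where
  "power_graph G =
    \<lparr> pverts = carrier G,
      parcs = {(a, b). a \<in> carrier G \<and> b \<in> carrier G \<and> a \<noteq> b \<and>
                 (a \<in> generate G {b} \<or> b \<in> generate G {a})} \<rparr>"

definition enhanced_power_graph :: "('a, 'm) monoid_scheme \<Rightarrow> 'a pair_pre_digraph" where
  "enhanced_power_graph G =
    \<lparr> pverts = carrier G,
      parcs = {(a, b). a \<in> carrier G \<and> b \<in> carrier G \<and> a \<noteq> b \<and>
                 cyclic_group (subgroup_generated G {a, b})} \<rparr>"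

text \<open>Only edges are deleted; the vertex set is that of the first graph.\<close>

definition edge_difference ::
    "'a pair_pre_digraph \<Rightarrow> 'a pair_pre_digraph \<Rightarrow> 'a pair_pre_digraph" where
  "edge_difference H K = \<lparr> pverts = pverts H, parcs = parcs H - parcs K \<rparr>"

definition isolated_vertex :: "'a pair_pre_digraph \<Rightarrow> 'a \<Rightarrow> bool" where
  "isolated_vertex H v \<longleftrightarrow>
    v \<in> pverts H \<and> (\<forall>w \<in> pverts H. (v, w) \<notin> parcs H \<and> (w, v) \<notin> parcs H)"

definition remove_isolated :: "'a pair_pre_digraph \<Rightarrow> 'a pair_pre_digraph" where
  "remove_isolated H = \<lparr> pverts = {v \<in> pverts H. \<not> isolated_vertex H v}, parcs = parcs H \<rparr>"

definition difference_graph :: "('a, 'm) monoid_scheme \<Rightarrow> 'a pair_pre_digraph" where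
  "difference_graph G =
    remove_isolated (edge_difference (enhanced_power_graph G) (power_graph G))"

text \<open>
  The condition \<^term>\<open>x \<noteq> y\<close> is absorbed by \<^term>\<open>x \<notin> generate G {y}\<close>.
\<close>

lemma difference_graph_adj:
  "(x, y) \<in> parcs (difference_graph G) \<longleftrightarrow>
    x \<in> carrier G \<and> y \<in> carrier G \<and> cyclic_group (subgroup_generated G {x, y}) \<and>
    x \<notin> generate G {y} \<and> y \<notin> generate G {x}"
proof -
  have "x \<in> generate G {y}" if "x = y"
    using that by (simp add: generate.incl)
  then show ?thesis
    unfolding difference_graph_def remove_isolated_def edge_difference_def
      enhanced_power_graph_def power_graph_def
    by simp blast
qed

lemma difference_graph_sym:
  "(x, y) \<in> parcs (difference_graph G) \<Longrightarrow> (y, x) \<in> parcs (difference_graph G)"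
  unfolding difference_graph_adj insert_commute[of y x] by blast

lemma difference_graph_verts:
  "x \<in> pverts (difference_graph G) \<longleftrightarrow> (\<exists>y. (x, y) \<in> parcs (difference_graph G))"
proof -
  let ?H = "edge_difference (enhanced_power_graph G) (power_graph G)"
  have arcs: "parcs (difference_graph G) = parcs ?H"
    by (simp add: difference_graph_def remove_isolated_def)
  have verts: "pverts ?H = carrier G"
    by (simp add: edge_difference_def enhanced_power_graph_def)
  have "x \<in> pverts (difference_graph G) \<longleftrightarrow>
      x \<in> carrier G \<and> (\<exists>w \<in> carrier G. (x, w) \<in> parcs ?H \<or> (w, x) \<in> parcs ?H)"
    unfolding difference_graph_def remove_isolated_def isolated_vertex_def by (simp add: verts) blast
  also have "\<dots> \<longleftrightarrow> (\<exists>y. (x, y) \<in> parcs ?H)"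
    unfolding arcs[symmetric] using difference_graph_sym difference_graph_adj by metis
  finally show ?thesis
    unfolding arcs .
qed

end

theory Submission
  imports Defs "HOL-Algebra.Multiplicative_Group" "HOL-Computational_Algebra.Primes"
begin

text \<open>
  If \<open>x \<sim> y\<close>, then suitable powers of \<open>x\<close> and \<open>y\<close> connect \<open>x\<close> to an element \<open>u\<close> of prime order \<open>p\<close>
  that commutes with an element \<open>v\<close> of another prime order \<open>q\<close>; conversely, commuting nontrivial
  elements of coprime orders are adjacent. So it is enough to connect such a \<open>u\<close> to a 3-cycle, and
  any two 3-cycles are adjacent to a common disjoint double transposition.

  An element of order 2 or 3 with enough fixed points commutes with a disjoint 3-cycle or double
  transposition. One with few fixed points has many nontrivial cycles: permuting three 2-cycles of
  an involution cyclically, or exchanging two pairs of 3-cycles of an element of order 3, gives a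
  commuting element of order 3 or 2 with many fixed points. Finally, if \<open>p \<noteq> 3\<close> and \<open>q \<noteq> 2\<close>, some
  point \<open>a\<close> is moved by \<open>v\<close>, the \<open>u\<close>-orbits of \<open>a\<close>, \<open>v a\<close> and \<open>v (v a)\<close> are disjoint, and \<open>v\<close> induces
  an element of order 3 that permutes them cyclically and commutes with \<open>u\<close>.
\<close>

section \<open>Cyclic subgroups and adjacency in groups\<close>

text \<open>By Bezout, the generator on the right is a product of powers of the two on the left.
  Hence any two elements of a cyclic group generate a cyclic group.\<close>

lemma (in group) generate_int_pow_pair:
  fixes i j :: int
  assumes z: "z \<in> carrier G"
  shows "generate G {z [^] i, z [^] j} = generate G {z [^] gcd i j}"
proof
  have "z [^] i \<in> generate G {z [^] gcd i j}" "z [^] j \<in> generate G {z [^] gcd i j}"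
    using z by (auto simp: generate_pow int_pow_pow dvd_def elim!: dvdE[OF gcd_dvd1] dvdE[OF gcd_dvd2])
      (metis dvd_div_mult_self gcd_dvd1 mult.commute, metis dvd_div_mult_self gcd_dvd2 mult.commute)
  then show "generate G {z [^] i, z [^] j} \<subseteq> generate G {z [^] gcd i j}"
    using z by (intro generate_subgroup_incl generate_is_subgroup) auto
next
  obtain u v where uv: "u * i + v * j = gcd i j"
    using bezout_int by blast
  interpret S: subgroup "generate G {z [^] i, z [^] j}" G
    using z by (intro generate_is_subgroup) auto
  have "z [^] i \<in> generate G {z [^] i, z [^] j}" "z [^] j \<in> generate G {z [^] i, z [^] j}"
    by (auto intro: generate.incl)
  then have "(z [^] i) [^] u \<otimes> (z [^] j) [^] v \<in> generate G {z [^] i, z [^] j}"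
    using subgroup_int_pow_closed[OF S.subgroup_axioms] by blast
  also have "(z [^] i) [^] u \<otimes> (z [^] j) [^] v = z [^] gcd i j"
    using z by (simp add: int_pow_pow int_pow_mult uv[symmetric] mult.commute)
  finally show "generate G {z [^] gcd i j} \<subseteq> generate G {z [^] i, z [^] j}"
    by (intro generate_subgroup_incl S.subgroup_axioms) auto
qed

text \<open>Turns cyclicity into the existence of a common root \<open>z\<close>, in which
  membership is a matter of exponents.\<close>

lemma (in group) cyclic_group_pair_iff:
  assumes x: "x \<in> carrier G" and y: "y \<in> carrier G"
  shows "cyclic_group (subgroup_generated G {x, y}) \<longleftrightarrow>
    (\<exists>z \<in> carrier G. x \<in> generate G {z} \<and> y \<in> generate G {z})"
proof
  have xy: "carrier (subgroup_generated G {x, y}) = generate G {x, y}"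
    using x y by (simp add: carrier_subgroup_generated)
  assume "cyclic_group (subgroup_generated G {x, y})"
  then obtain z where z: "z \<in> carrier (subgroup_generated G {x, y})"
      "carrier (subgroup_generated G {x, y}) = range (\<lambda>n::int. z [^]\<^bsub>subgroup_generated G {x, y}\<^esub> n)"
    using group.cyclic_group[OF group_subgroup_generated] by blast
  then have zG: "z \<in> carrier G"
    using carrier_subgroup_generated_subset by blast
  have "generate G {x, y} = generate G {z}"
    using z(2) zG unfolding xy int_pow_subgroup_generated[OF z(1)] by (auto simp: generate_pow)
  then show "\<exists>z \<in> carrier G. x \<in> generate G {z} \<and> y \<in> generate G {z}"
    using zG by (metis generate.incl insertCI)
next
  assume "\<exists>z \<in> carrier G. x \<in> generate G {z} \<and> y \<in> generate G {z}"
  then obtain z i j where z: "z \<in> carrier G" "x = z [^] (i::int)" "y = z [^] (j::int)"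
    by (auto simp: generate_pow)
  then have "generate G {x, y} = generate G {z [^] gcd i j}"
    using generate_int_pow_pair by simp
  then have "subgroup_generated G {x, y} = subgroup_generated G {z [^] gcd i j}"
    using x y z unfolding subgroup_generated_def by simp
  then show "cyclic_group (subgroup_generated G {x, y})"
    using cyclic_group_generated by simp
qed

text \<open>Let \<open>w\<close> generate the same subgroup as \<open>x\<close> and \<open>y\<close>
  together. The exponent \<open>ord y\<close> kills both, hence \<open>w\<close>, so the subgroup of
  \<open>w\<close> is no larger than that of \<open>y\<close>, which it contains; the two coincide.
  Consequently neither order divides the other for adjacent vertices.\<close>

lemma (in group) mem_generate_if_ord_dvd:
  assumes z: "z \<in> carrier G" and x: "x \<in> generate G {z}" and y: "y \<in> generate G {z}"
    and fin: "finite (carrier G)" and dvd: "ord x dvd ord y"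
  shows "x \<in> generate G {y}"
proof -
  obtain i j where ij: "x = z [^] (i::int)" "y = z [^] (j::int)"
    using x y z by (auto simp: generate_pow)
  define w where "w = z [^] gcd i j"
  have wG: "w \<in> carrier G" and yG: "y \<in> carrier G" and xG: "x \<in> carrier G"
    using z ij by (auto simp: w_def)
  have gen: "generate G {x, y} = generate G {w}"
    unfolding ij w_def by (rule generate_int_pow_pair[OF z])
  have "x [^] int (ord y) = \<one>" "y [^] int (ord y) = \<one>"
    using dvd xG yG by (auto simp: int_pow_eq_id)
  then have "int (ord z) dvd i * int (ord y)" "int (ord z) dvd j * int (ord y)"
    using z ij by (auto simp: int_pow_pow simp flip: int_pow_eq_id)
  then have "int (ord z) dvd gcd i j * int (ord y)"
    by (metis gcd_greatest gcd_mult_right abs_of_nat mult.commute gcd_mult_distrib_int)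
  then have "w [^] int (ord y) = \<one>"
    using z by (simp add: w_def int_pow_pow int_pow_eq_id)
  then have "ord w dvd ord y"
    using wG by (simp add: int_pow_eq_id)
  then have le: "card (generate G {w}) \<le> card (generate G {y})"
    using wG yG ord_ge_1[OF fin yG]
    by (auto simp flip: generate_pow_card intro: dvd_imp_le)
  have "generate G {y} \<subseteq> generate G {w}"
    unfolding gen[symmetric] by (intro mono_generate) auto
  moreover have "finite (generate G {w})"
    using fin wG generate_incl[of "{w}"] by (auto intro: finite_subset)
  ultimately have "generate G {y} = generate G {w}"
    using le by (metis card_seteq)
  then show ?thesis
    using gen by (metis generate.incl insertCI)
qed

text \<open>Bezout makes \<open>x\<close> and \<open>y\<close> powers of their product, while
  coprime orders prevent either from being a power of the other. The numbers \<open>p\<close> and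
  \<open>q\<close> may be any exponents that kill \<open>x\<close> and \<open>y\<close>.\<close>

lemma (in group) difference_graph_adj_if_coprime:
  fixes p q :: nat
  assumes x: "x \<in> carrier G" "x \<noteq> \<one>" "x [^] p = \<one>"
    and y: "y \<in> carrier G" "y \<noteq> \<one>" "y [^] q = \<one>"
    and comm: "x \<otimes> y = y \<otimes> x" and cop: "coprime p q"
  shows "(x, y) \<in> parcs (difference_graph G)"
proof -
  have ox: "ord x dvd p" and oy: "ord y dvd q"
    using x y by (auto simp: pow_eq_id)
  then have oxy: "coprime (ord x) (ord y)"
    using cop by (meson coprime_divisors)
  have notin: "b \<notin> generate G {a}"
    if ab: "a \<in> carrier G" "b \<in> carrier G" "b \<noteq> \<one>" "coprime (ord a) (ord b)" for a b
  proof
    assume "b \<in> generate G {a}"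
    then obtain i where "b = a [^] (i::int)"
      using ab by (auto simp: generate_pow)
    then have "b [^] int (ord a) = \<one>"
      using ab by (simp add: int_pow_pow int_pow_eq_id)
    then have "ord b dvd ord a"
      using ab by (simp add: int_pow_eq_id)
    then have "ord b = 1"
      using ab(4) by (metis coprime_common_divisor_nat dvd_refl nat_dvd_1_iff_1)
    then show False
      using ab ord_eq_1 by simp
  qed
  have "\<exists>k::int. (x \<otimes> y) [^] k = x"
    and "\<exists>k::int. (x \<otimes> y) [^] k = y"
  proof -
    obtain u v where uv: "u * int (ord x) + v * int (ord y) = 1"
      using bezout_int[of "int (ord x)" "int (ord y)"] oxy
      by (metis coprime_int_iff coprime_imp_gcd_eq_1)
    \<comment> \<open>One exponent is 1 modulo \<open>ord x\<close> and 0 modulo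
      \<open>ord y\<close>, the other the reverse, so these powers of the product pick out
      \<open>x\<close> and \<open>y\<close>.\<close>
    have *: "u * int (ord x) = 1 - v * int (ord y)" "v * int (ord y) = 1 - u * int (ord x)"
      using uv by auto
    have "(x \<otimes> y) [^] (v * int (ord y)) = x [^] (v * int (ord y)) \<otimes> y [^] (v * int (ord y))"
      using x y by (intro int_pow_mult_distrib comm)
    moreover have "x [^] (v * int (ord y)) = x [^] (1::int)" "y [^] (v * int (ord y)) = \<one>"
      using x y by (simp_all add: int_pow_eq int_pow_eq_id flip: *(1) del: int_pow_1)
    ultimately show "\<exists>k::int. (x \<otimes> y) [^] k = x"
      using x y by (intro exI[of _ "v * int (ord y)"]) simp
    have "(x \<otimes> y) [^] (u * int (ord x)) = x [^] (u * int (ord x)) \<otimes> y [^] (u * int (ord x))"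
      using x y by (intro int_pow_mult_distrib comm)
    moreover have "y [^] (u * int (ord x)) = y [^] (1::int)" "x [^] (u * int (ord x)) = \<one>"
      using x y by (simp_all add: int_pow_eq int_pow_eq_id flip: *(2) del: int_pow_1)
    ultimately show "\<exists>k::int. (x \<otimes> y) [^] k = y"
      using x y by (intro exI[of _ "u * int (ord x)"]) simp
  qed
  then have "x \<in> generate G {x \<otimes> y}" "y \<in> generate G {x \<otimes> y}"
    using x y by (auto simp: generate_pow) metis+
  then have "cyclic_group (subgroup_generated G {x, y})"
    using x y by (subst cyclic_group_pair_iff) auto
  then show ?thesis
    unfolding difference_graph_adj using x y notin oxy by (simp add: coprime_commute)
qed

lemma prime_multiplicity_less_if_not_dvd:
  fixes a b :: nat
  assumes "\<not> a dvd b" "a > 0"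
  shows "\<exists>p. prime p \<and> multiplicity p b < multiplicity p a"
proof (rule ccontr)
  assume "\<nexists>p. prime p \<and> multiplicity p b < multiplicity p a"
  then have "a dvd b"
    using assms(2) by (intro multiplicity_le_imp_dvd) (auto simp: not_less)
  then show False
    using assms(1) by contradiction
qed

text \<open>The path is \<open>x\<close>, \<open>y'\<close>, \<open>u\<close>: here
  \<open>y'\<close> is a power of \<open>y\<close> of prime power order \<open>q ^ b\<close>, and
  \<open>u\<close> a power of \<open>x\<close> of prime order \<open>p\<close>. The element
  \<open>v\<close> is a power of \<open>y'\<close>; everything lies in one cyclic group and so
  commutes.\<close>

lemma (in group) difference_graph_connected_to_prime_order:
  assumes adj: "(x, y) \<in> parcs (difference_graph G)" and fin: "finite (carrier G)"
  obtains u v and p q :: nat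
  where "(x, u) \<in> (parcs (difference_graph G))\<^sup>*" "prime p" "prime q" "p \<noteq> q"
    "u \<in> carrier G" "u \<noteq> \<one>" "u [^] p = \<one>" "v \<in> carrier G" "v \<noteq> \<one>" "v [^] q = \<one>"
    "u \<otimes> v = v \<otimes> u"
proof -
  have x: "x \<in> carrier G" and y: "y \<in> carrier G" and nin: "x \<notin> generate G {y}" "y \<notin> generate G {x}"
    and cyc: "cyclic_group (subgroup_generated G {x, y})"
    using adj by (auto simp: difference_graph_adj)
  obtain z where z: "z \<in> carrier G" "x \<in> generate G {z}" "y \<in> generate G {z}"
    using cyc x y by (auto simp: cyclic_group_pair_iff)
  have comm: "a \<otimes> b = b \<otimes> a" if "a \<in> generate G {z}" "b \<in> generate G {z}" for a b
    using that z by (auto simp: generate_pow simp flip: int_pow_mult) (simp add: add.commute)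
  have pow: "a [^] (k::nat) \<in> generate G {z}" if a: "a \<in> generate G {z}" for a k
    using a z subgroup_int_pow_closed[OF generate_is_subgroup, of "{z}" a "int k"] by (simp add: int_pow_int)
  have ndvd: "\<not> ord x dvd ord y" "\<not> ord y dvd ord x"
    using mem_generate_if_ord_dvd z fin nin by blast+
  have pos: "ord x > 0" "ord y > 0"
    using ord_ge_1[OF fin] x y by fastforce+
  obtain q where q: "prime q" "multiplicity q (ord x) < multiplicity q (ord y)"
    using prime_multiplicity_less_if_not_dvd[OF ndvd(2) pos(2)] by blast
  define b where "b = multiplicity q (ord y)"
  have b: "q ^ b dvd ord y" "\<not> q ^ b dvd ord x"
  proof -
    have "q ^ b dvd ord x \<Longrightarrow> b \<le> multiplicity q (ord x)"
      using q(1) pos by (intro multiplicity_geI) auto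
    then show "q ^ b dvd ord y" "\<not> q ^ b dvd ord x"
      using q(2) by (auto simp: b_def multiplicity_dvd)
  qed
  \<comment> \<open>Otherwise \<open>ord x\<close> would divide \<open>ord y\<close>.\<close>
  have bx: "\<not> ord x dvd q ^ b"
    using q ndvd(1) b(1) dvd_trans by blast
  define y' where "y' = y [^] (ord y div q ^ b)"
  have y': "y' \<in> carrier G" "y' \<in> generate G {z}"
    using y z pow by (auto simp: y'_def)
  have oy': "ord y' = q ^ b"
    unfolding y'_def using y b pos q
    by (subst ord_pow) (auto simp: div_dvd_iff_mult dvd_div_eq_0_iff elim!: dvdE)
  have xy': "(x, y') \<in> parcs (difference_graph G)"
  proof -
    have "x \<notin> generate G {y'}" "y' \<notin> generate G {x}"
    proof -
      have *: "ord c dvd ord d" if "c \<in> generate G {d}" "d \<in> carrier G" for c d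
        using that by (auto simp: generate_pow int_pow_pow simp flip: int_pow_eq_id int_dvd_int_iff)
          (simp add: mult.commute int_pow_eq_id int_pow_pow)
      show "x \<notin> generate G {y'}" "y' \<notin> generate G {x}"
        using *[of x y'] *[of y' x] x y' oy' b bx by auto
    qed
    then show ?thesis
      using x y' z by (auto simp: difference_graph_adj cyclic_group_pair_iff)
  qed
  \<comment> \<open>Some prime occurs more often in \<open>ord x\<close> than in
    \<open>q ^ b\<close>. It is not \<open>q\<close>, whose multiplicity in \<open>ord x\<close> is
    below \<open>b\<close>.\<close>
  obtain p where p: "prime p" "p dvd ord x" "p \<noteq> q"
  proof -
    obtain p where p: "prime p" "multiplicity p (q ^ b) < multiplicity p (ord x)"
      using prime_multiplicity_less_if_not_dvd[OF bx pos(1)] by blast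
    have "p \<noteq> q"
      using p q b_def by (auto simp: multiplicity_prime_power not_less)
    moreover have "p dvd ord x"
      using p(2) by (metis not_dvd_imp_multiplicity_0 not_less_zero)
    ultimately show ?thesis
      using that p by blast
  qed
  define u where "u = x [^] (ord x div p)"
  have ou: "ord u = p"
    unfolding u_def using x p pos by (subst ord_pow) (auto elim!: dvdE)
  have u: "u \<in> carrier G" "u \<in> generate G {z}"
    using x z pow by (auto simp: u_def)
  have qb: "q dvd ord y'"
    using oy' b(2) by (cases b) auto
  have oy'_pos: "ord y' > 0"
    using oy' q(1) by (simp add: prime_gt_0_nat)
  define v where "v = y' [^] (ord y' div q)"
  have ov: "ord v = q"
    unfolding v_def using y' qb q prime_gt_0_nat[OF q(1)] oy'_pos by (subst ord_pow) (auto elim!: dvdE)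
  have v: "v \<in> carrier G" "v \<in> generate G {z}"
    using y' z pow by (auto simp: v_def)
  have "(y', u) \<in> parcs (difference_graph G)"
  proof (rule difference_graph_adj_if_coprime)
    show "y' [^] (q ^ b) = \<one>" "u [^] p = \<one>"
      using oy' ou y' u by (auto simp: pow_eq_id)
    show "y' \<noteq> \<one>" "u \<noteq> \<one>"
      using ou qb p q ord_eq_1 y' u by (metis not_prime_1 not_prime_unit dvd_refl)+
    show "coprime (q ^ b) p"
      using p q by (simp add: primes_coprime)
  qed (use y' u comm in auto)
  then have xu: "(x, u) \<in> (parcs (difference_graph G))\<^sup>*"
    using xy' by auto
  show ?thesis
  proof (rule that[OF xu p(1) q(1) p(3) u(1) _ _ v(1)])
    show "u \<noteq> \<one>" "v \<noteq> \<one>"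
      using ou ov p q ord_eq_1 u v not_prime_1 by metis+
    show "u [^] p = \<one>" "v [^] q = \<one>"
      using ou ov u v by (auto simp: pow_eq_id)
    show "u \<otimes> v = v \<otimes> u"
      using comm u v by simp
  qed
qed

section \<open>Permutations in the alternating group\<close>

lemma alt_group_nat_pow: "x [^]\<^bsub>alt_group n\<^esub> (k::nat) = x ^^ k"
proof -
  interpret group "alt_group n"
    by (rule alt_group_is_group)
  show ?thesis
    by (induction k) (simp_all add: alt_group_mult alt_group_one funpow_Suc_right del: funpow.simps(2))
qed

abbreviation alt_adj :: "nat \<Rightarrow> ((nat \<Rightarrow> nat) \<times> (nat \<Rightarrow> nat)) set" where
  "alt_adj n \<equiv> parcs (difference_graph (alt_group n))"

lemma alt_adjI:
  assumes "x \<in> carrier (alt_group n)" "x \<noteq> id" "x ^^ p = id"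
    and "y \<in> carrier (alt_group n)" "y \<noteq> id" "y ^^ q = id"
    and "x \<circ> y = y \<circ> x" "coprime p q"
  shows "(x, y) \<in> alt_adj n"
  using group.difference_graph_adj_if_coprime[OF alt_group_is_group[of n], of x p y q] assms
  by (simp add: alt_group_mult alt_group_one alt_group_nat_pow)

lemma alt_adj_rtrancl_sym: "(x, y) \<in> (alt_adj n)\<^sup>* \<Longrightarrow> (y, x) \<in> (alt_adj n)\<^sup>*"
  by (meson difference_graph_sym sym_rtrancl symD symI)

lemma alt_group_bij: "x \<in> carrier (alt_group n) \<Longrightarrow> bij x"
  by (auto simp: alt_group_carrier intro: permutes_bij)

text \<open>By injectivity, \<open>f\<close> maps \<open>A\<close> into itself and \<open>g\<close>
  maps the complement of \<open>A\<close> into itself, so at each point only one of the two maps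
  acts.\<close>

lemma disjoint_support_commute:
  assumes inj: "inj f" "inj g"
    and f: "\<And>s. s \<notin> A \<Longrightarrow> f s = s" and g: "\<And>s. s \<in> A \<Longrightarrow> g s = s"
  shows "f \<circ> g = g \<circ> f"
proof
  fix s
  show "(f \<circ> g) s = (g \<circ> f) s"
  proof (cases "s \<in> A")
    case True
    then have "f s \<in> A"
      using f[of "f s"] injD[OF inj(1), of "f s" s] by metis
    then show ?thesis
      using g True by simp
  next
    case False
    then have "g s \<notin> A"
      using g[of "g s"] injD[OF inj(2), of "g s" s] by metis
    then show ?thesis
      using f False by simp
  qed
qed

text \<open>Used to choose points one after another. The bound is on the length, so the excluded
  points may repeat.\<close>

lemma ex_notin_list: "length xs < card S \<Longrightarrow> \<exists>a\<in>S. a \<notin> set xs"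
  by (metis card_length card_mono finite_set leD le_trans subsetI)

text \<open>For distinct points this sends \<open>a\<close> to \<open>b\<close>, \<open>b\<close> to
  \<open>c\<close> and \<open>c\<close> to \<open>a\<close>. As a product of two transpositions it
  is visibly even.\<close>

abbreviation three_cycle :: "nat \<Rightarrow> nat \<Rightarrow> nat \<Rightarrow> nat \<Rightarrow> nat" where
  "three_cycle a b c \<equiv> transpose a b \<circ> transpose b c"

text \<open>The two transpositions may share a point, so this covers 3-cycles as well as double
  transpositions.\<close>

lemma alt_group_comp_transposes:
  assumes "a \<in> {1..n}" "b \<in> {1..n}" "c \<in> {1..n}" "d \<in> {1..n}" "a \<noteq> b" "c \<noteq> d"
  shows "transpose a b \<circ> transpose c d \<in> carrier (alt_group n)"
  using assms
  by (simp add: alt_group_carrier permutes_compose permutes_swap_id evenperm_comp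
      permutation_swap_id evenperm_swap)

lemma three_cycle_pow:
  assumes "distinct [a, b, c]"
  shows "three_cycle a b c ^^ 3 = id" "three_cycle a b c \<noteq> id"
  using assms by (auto simp: fun_eq_iff numeral_3_eq_3 transpose_def)

lemma double_transposition_pow:
  assumes "distinct [a, b, c, d]"
  shows "(transpose a b \<circ> transpose c d) ^^ 2 = id" "transpose a b \<circ> transpose c d \<noteq> id"
  using assms by (auto simp: fun_eq_iff numeral_2_eq_2 transpose_def)

text \<open>Conjugation relabels the points of a cycle; this form avoids the inverse of
  \<open>f\<close>.\<close>

lemma comp_three_cycle:
  "inj f \<Longrightarrow> f \<circ> three_cycle a b c = three_cycle (f a) (f b) (f c) \<circ> f"
  by (auto simp: fun_eq_iff transpose_def inj_eq)

lemma inj_three_cycle: "inj (three_cycle a b c)"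
  by (simp add: inj_compose)

lemma three_cycle_fixed: "s \<notin> {a, b, c} \<Longrightarrow> three_cycle a b c s = s"
  by (simp add: transpose_def)

lemma double_transposition_fixed:
  "s \<notin> {a, b, c, d} \<Longrightarrow> (transpose a b \<circ> transpose c d) s = s"
  by (simp add: transpose_def)

lemma inj_double_transposition: "inj (transpose a b \<circ> transpose c d)"
  by (simp add: inj_compose)

section \<open>Elements with enough fixed points\<close>

text \<open>The points of both cycles number at most six, so \<open>n \<ge> 10\<close> leaves four
  for a double transposition disjoint from both.\<close>

lemma three_cycle_connected:
  assumes n: "n \<ge> 10" and abc: "distinct [a, b, c]" "set [a, b, c] \<subseteq> {1..n}"
  shows "(three_cycle a b c, three_cycle 1 2 3) \<in> (alt_adj n)\<^sup>*"
proof -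
  obtain d1 where d1: "d1 \<in> {1..n}" "d1 \<notin> set [a, b, c, 1, 2, 3]"
    using ex_notin_list[of "[a, b, c, 1, 2, 3]" "{1..n}"] n by auto
  obtain d2 where d2: "d2 \<in> {1..n}" "d2 \<notin> set [a, b, c, 1, 2, 3, d1]"
    using ex_notin_list[of "[a, b, c, 1, 2, 3, d1]" "{1..n}"] n by auto
  obtain d3 where d3: "d3 \<in> {1..n}" "d3 \<notin> set [a, b, c, 1, 2, 3, d1, d2]"
    using ex_notin_list[of "[a, b, c, 1, 2, 3, d1, d2]" "{1..n}"] n by auto
  obtain d4 where d4: "d4 \<in> {1..n}" "d4 \<notin> set [a, b, c, 1, 2, 3, d1, d2, d3]"
    using ex_notin_list[of "[a, b, c, 1, 2, 3, d1, d2, d3]" "{1..n}"] n by auto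
  have dd: "distinct [d1, d2, d3, d4]"
    using d2 d3 d4 by auto
  let ?t = "transpose d1 d2 \<circ> transpose d3 d4"
  have adj: "(three_cycle u v w, ?t) \<in> alt_adj n"
    if uvw: "distinct [u, v, w]" "set [u, v, w] \<subseteq> {1..n}" "set [u, v, w] \<subseteq> {a, b, c, 1, 2, 3}" for u v w
  proof (rule alt_adjI[where p = 3 and q = 2])
    have "s \<notin> {d1, d2, d3, d4}" if "s \<in> {u, v, w}" for s
      using that uvw(3) d1 d2 d3 d4 by auto
    then show "three_cycle u v w \<circ> ?t = ?t \<circ> three_cycle u v w"
      by (intro disjoint_support_commute[where A = "{u, v, w}"] inj_double_transposition
          inj_three_cycle three_cycle_fixed double_transposition_fixed)
    show "three_cycle u v w \<in> carrier (alt_group n)"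
      by (rule alt_group_comp_transposes) (use uvw(1,2) in auto)
    show "?t \<in> carrier (alt_group n)"
      by (rule alt_group_comp_transposes) (use d1(1) d2(1) d3(1) d4(1) dd in auto)
    show "three_cycle u v w ^^ 3 = id" "three_cycle u v w \<noteq> id" "?t ^^ 2 = id" "?t \<noteq> id"
      using three_cycle_pow[OF uvw(1)] double_transposition_pow[OF dd] by blast+
  qed simp
  have "(three_cycle a b c, ?t) \<in> alt_adj n" "(three_cycle 1 2 3, ?t) \<in> alt_adj n"
    using abc n by (auto intro!: adj)
  then show ?thesis
    by (meson difference_graph_sym r_into_rtrancl rtrancl_trans)
qed

text \<open>A 3-cycle on fixed points of \<open>f\<close> commutes with \<open>f\<close>.\<close>

lemma connected_if_three_fixed_points:
  assumes n: "n \<ge> 10" and f: "f \<in> carrier (alt_group n)" "f ^^ p = id" "f \<noteq> id" "coprime p 3"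
    and fixd: "card {s \<in> {1..n}. f s = s} \<ge> 3"
  shows "(f, three_cycle 1 2 3) \<in> (alt_adj n)\<^sup>*"
proof -
  let ?F = "{s \<in> {1..n}. f s = s}"
  obtain a where a: "a \<in> ?F"
    using ex_notin_list[of "[]" ?F] fixd by auto
  obtain b where b: "b \<in> ?F" "b \<notin> set [a]"
    using ex_notin_list[of "[a]" ?F] fixd by auto
  obtain c where c: "c \<in> ?F" "c \<notin> set [a, b]"
    using ex_notin_list[of "[a, b]" ?F] fixd by auto
  have abc: "distinct [a, b, c]" "set [a, b, c] \<subseteq> {1..n}"
    using a b c by auto
  have "f \<circ> three_cycle a b c = three_cycle a b c \<circ> f"
    using comp_three_cycle[of f a b c] a b c alt_group_bij[OF f(1)] by (simp add: bij_is_inj)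
  then have "(f, three_cycle a b c) \<in> alt_adj n"
    using f three_cycle_pow[OF abc(1)] abc
    by (intro alt_adjI[where p = p and q = 3] alt_group_comp_transposes) auto
  with three_cycle_connected[OF n abc] show ?thesis
    by (meson converse_rtrancl_into_rtrancl)
qed

lemma card_fixed_points_ge:
  assumes "\<And>s. s \<notin> set xs \<Longrightarrow> f s = s"
  shows "card {s \<in> {1..n}. f s = s} \<ge> n - length xs"
proof -
  have "n - length xs \<le> card {1..n} - card (set xs)"
    by (simp add: card_length diff_le_mono2)
  also have "\<dots> \<le> card ({1..n} - set xs)"
    by (rule diff_card_le_card_Diff) simp
  also have "\<dots> \<le> card {s \<in> {1..n}. f s = s}"
    using assms by (intro card_mono) auto
  finally show ?thesis .
qed

lemma card_moved_points:
  "card {s \<in> {1..n}. f s = s} + card {s \<in> {1..n}. f s \<noteq> s} = n"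
proof -
  have "{s \<in> {1..n}. f s = s} \<union> {s \<in> {1..n}. f s \<noteq> s} = {1..n}"
    by auto
  then show ?thesis
    by (metis (no_types, lifting) card_Un_disjoint card_atLeastAtMost diff_Suc_1 disjoint_iff
        finite_Un finite_atLeastAtMost mem_Collect_eq)
qed

text \<open>A 3-cycle would not have order coprime to that of \<open>f\<close>, so a double
  transposition on four fixed points is inserted. It moves only four points and falls under the
  previous case.\<close>

lemma connected_if_order_3_and_four_fixed_points:
  assumes n: "n \<ge> 10" and f: "f \<in> carrier (alt_group n)" "f ^^ 3 = id" "f \<noteq> id"
    and fixd: "card {s \<in> {1..n}. f s = s} \<ge> 4"
  shows "(f, three_cycle 1 2 3) \<in> (alt_adj n)\<^sup>*"
proof -
  let ?F = "{s \<in> {1..n}. f s = s}"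
  obtain a where a: "a \<in> ?F"
    using ex_notin_list[of "[]" ?F] fixd by auto
  obtain b where b: "b \<in> ?F" "b \<notin> set [a]"
    using ex_notin_list[of "[a]" ?F] fixd by auto
  obtain c where c: "c \<in> ?F" "c \<notin> set [a, b]"
    using ex_notin_list[of "[a, b]" ?F] fixd by auto
  obtain d where d: "d \<in> ?F" "d \<notin> set [a, b, c]"
    using ex_notin_list[of "[a, b, c]" ?F] fixd by auto
  let ?t = "transpose a b \<circ> transpose c d"
  have abcd: "distinct [a, b, c, d]"
    using b c d by auto
  have t: "?t \<in> carrier (alt_group n)" "?t ^^ 2 = id" "?t \<noteq> id"
    using a b c d double_transposition_pow[OF abcd] by (auto intro!: alt_group_comp_transposes)
  have "f \<circ> ?t = ?t \<circ> f"
    using a b c d alt_group_bij[OF f(1)]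
    by (intro disjoint_support_commute[symmetric, where A = "{a, b, c, d}"]
        inj_double_transposition double_transposition_fixed) (auto simp: bij_is_inj)
  then have "(f, ?t) \<in> alt_adj n"
    using f t by (intro alt_adjI[where p = 3 and q = 2]) auto
  moreover have "card {s \<in> {1..n}. ?t s = s} \<ge> 3"
    using card_fixed_points_ge[of "[a, b, c, d]" ?t n] double_transposition_fixed[of _ a b c d] n
    by simp
  then have "(?t, three_cycle 1 2 3) \<in> (alt_adj n)\<^sup>*"
    using n t by (intro connected_if_three_fixed_points[where p = 2]) auto
  ultimately show ?thesis
    by (meson converse_rtrancl_into_rtrancl)
qed

section \<open>Elements of order 2 and 3\<close>

lemma involution_connected:
  assumes n: "n \<ge> 10" and f: "f \<in> carrier (alt_group n)" "f ^^ 2 = id" "f \<noteq> id"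
  shows "(f, three_cycle 1 2 3) \<in> (alt_adj n)\<^sup>*"
proof (cases "card {s \<in> {1..n}. f s = s} \<ge> 3")
  case True
  then show ?thesis
    using assms by (intro connected_if_three_fixed_points[where p = 2]) auto
next
  case False
  let ?M = "{s \<in> {1..n}. f s \<noteq> s}"
  \<comment> \<open>At most two fixed points leave at least eight moved ones, enough to choose three
    2-cycles of \<open>f\<close>.\<close>
  have M: "card ?M > 5"
    using False card_moved_points[of n f] n by linarith
  have inj: "inj f"
    using alt_group_bij[OF f(1)] by (rule bij_is_inj)
  have ff: "f (f s) = s" for s
    using fun_cong[OF f(2), of s] by (simp add: numeral_2_eq_2)
  have range: "f s \<in> {1..n} \<longleftrightarrow> s \<in> {1..n}" for s
    using f(1) by (auto simp: alt_group_carrier permutes_in_image simp del: atLeastAtMost_iff)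
  obtain a where a: "a \<in> ?M"
    using ex_notin_list[of "[]" ?M] M by auto
  obtain b where b: "b \<in> ?M" "b \<notin> set [a, f a]"
    using ex_notin_list[of "[a, f a]" ?M] M by auto
  obtain c where c: "c \<in> ?M" "c \<notin> set [a, f a, b, f b]"
    using ex_notin_list[of "[a, f a, b, f b]" ?M] M by auto
  let ?u = "three_cycle a b c" and ?v = "three_cycle (f a) (f b) (f c)"
  \<comment> \<open>Otherwise applying \<open>f\<close> would put \<open>b\<close> or
    \<open>c\<close> among the points excluded in its choice.\<close>
  have "f b \<noteq> a" "f c \<noteq> a" "f c \<noteq> b"
    using b(2) c(2) ff[of b] ff[of c] by auto
  then have dist: "distinct [a, b, c]" "distinct [f a, f b, f c]" "distinct [a, b, c, f a, f b, f c]"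
    using a b c by (auto simp: inj_eq[OF inj])
  have uv: "?u \<circ> ?v = ?v \<circ> ?u"
  proof (intro disjoint_support_commute[where A = "{a, b, c}"] inj_three_cycle three_cycle_fixed)
    show "s \<notin> {f a, f b, f c}" if "s \<in> {a, b, c}" for s
      using that dist(3) by auto
  qed
  interpret group "alt_group n"
    by (rule alt_group_is_group)
  have carr: "?u \<in> carrier (alt_group n)" "?v \<in> carrier (alt_group n)"
    using a b c dist(1,2) range by (auto intro!: alt_group_comp_transposes simp del: atLeastAtMost_iff)
  \<comment> \<open>This permutes the pairs of \<open>a\<close>, \<open>b\<close>, \<open>c\<close>
    with their images cyclically.\<close>
  let ?w = "?u \<circ> ?v"
  have w: "?w \<in> carrier (alt_group n)"
    using m_closed[OF carr] by (simp add: alt_group_mult)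
  have "?w ^^ 3 = (?u ^^ 3) \<circ> (?v ^^ 3)"
    using pow_mult_distrib[OF _ carr, of 3] uv by (simp add: alt_group_mult alt_group_nat_pow)
  then have w3: "?w ^^ 3 = id"
    using three_cycle_pow(1) dist by simp
  have "a \<notin> {f a, f b, f c}"
    using dist(3) by auto
  then have "?w a = b"
    using three_cycle_fixed[of a "f a" "f b" "f c"] dist(1) by (simp add: transpose_def)
  then have wid: "?w \<noteq> id"
    using dist(1) by (metis distinct_length_2_or_more id_apply)
  \<comment> \<open>Conjugation by the involution \<open>f\<close> exchanges \<open>?u\<close> and
    \<open>?v\<close>, and these commute.\<close>
  have "f \<circ> ?w = (f \<circ> ?u) \<circ> ?v"
    by (simp only: comp_assoc)
  also have "\<dots> = ?v \<circ> (f \<circ> ?v)"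
    unfolding comp_three_cycle[OF inj, of a b c] by (simp only: comp_assoc)
  also have "\<dots> = ?v \<circ> ?u \<circ> f"
    unfolding comp_three_cycle[OF inj, of "f a" "f b" "f c"] ff by (simp only: comp_assoc)
  also have "\<dots> = ?w \<circ> f"
    by (simp only: uv)
  finally have "(f, ?w) \<in> alt_adj n"
    using f w w3 wid by (intro alt_adjI[where p = 2 and q = 3]) auto
  \<comment> \<open>Six possibly moved points and \<open>n \<ge> 10\<close> leave the four fixed
    points required.\<close>
  moreover have "?w s = s" if "s \<notin> set [a, b, c, f a, f b, f c]" for s
    using that three_cycle_fixed[of s a b c] three_cycle_fixed[of s "f a" "f b" "f c"] by simp
  then have "card {s \<in> {1..n}. ?w s = s} \<ge> 4"
    using card_fixed_points_ge[of "[a, b, c, f a, f b, f c]" ?w n] n by simp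
  then have "(?w, three_cycle 1 2 3) \<in> (alt_adj n)\<^sup>*"
    using n w w3 wid by (intro connected_if_order_3_and_four_fixed_points)
  ultimately show ?thesis
    by (meson converse_rtrancl_into_rtrancl)
qed

lemma order_3_connected:
  assumes n: "n \<ge> 15" and f: "f \<in> carrier (alt_group n)" "f ^^ 3 = id" "f \<noteq> id"
  shows "(f, three_cycle 1 2 3) \<in> (alt_adj n)\<^sup>*"
proof (cases "card {s \<in> {1..n}. f s = s} \<ge> 4")
  case True
  then show ?thesis
    using n f by (intro connected_if_order_3_and_four_fixed_points) auto
next
  case False
  let ?M = "{s \<in> {1..n}. f s \<noteq> s}"
  \<comment> \<open>At most three fixed points leave at least twelve moved ones, more than the nine
    excluded when \<open>d\<close> is chosen.\<close>
  have M: "card ?M > 9"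
    using False card_moved_points[of n f] n by linarith
  have inj: "inj f"
    using alt_group_bij[OF f(1)] by (rule bij_is_inj)
  have fff: "f (f (f s)) = s" for s
    using fun_cong[OF f(2), of s] by (simp add: numeral_3_eq_3)
  have range: "f s \<in> {1..n} \<longleftrightarrow> s \<in> {1..n}" for s
    using f(1) by (auto simp: alt_group_carrier permutes_in_image simp del: atLeastAtMost_iff)
  \<comment> \<open>The orbit is a list so that \<open>distinct\<close> and \<open>length\<close>
    apply.\<close>
  define orb where "orb s = [s, f s, f (f s)]" for s
  obtain a where a: "a \<in> ?M"
    using ex_notin_list[of "[]" ?M] M by auto
  obtain b where b: "b \<in> ?M" "b \<notin> set (orb a)"
    using ex_notin_list[of "orb a" ?M] M by (auto simp: orb_def)
  obtain c where c: "c \<in> ?M" "c \<notin> set (orb a @ orb b)"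
    using ex_notin_list[of "orb a @ orb b" ?M] M by (auto simp: orb_def)
  obtain d where d: "d \<in> ?M" "d \<notin> set (orb a @ orb b @ orb c)"
    using ex_notin_list[of "orb a @ orb b @ orb c" ?M] M by (auto simp: orb_def)
  have f_in_orb: "f r \<in> set (orb s) \<longleftrightarrow> r \<in> set (orb s)" for r s
  proof -
    have "f r = s \<longleftrightarrow> r = f (f s)"
      using fff by metis
    then show ?thesis
      by (auto simp: orb_def inj_eq[OF inj])
  qed
  have orb_distinct: "distinct (orb s)" if "f s \<noteq> s" for s
  proof -
    have "f (f s) \<noteq> s"
      using that fff[of s] by metis
    then show ?thesis
      using that by (auto simp: orb_def inj_eq[OF inj])
  qed
  have orb_disjoint: "set (orb s) \<inter> set (orb t) = {}" if "t \<notin> set (orb s)" for s t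
  proof -
    have "f t \<notin> set (orb s)" "f (f t) \<notin> set (orb s)"
      using that by (simp_all add: f_in_orb)
    then show ?thesis
      using that by (simp add: orb_def[of t])
  qed
  \<comment> \<open>Exchanges two 3-cycles of \<open>f\<close> compatibly with \<open>f\<close>.
    Three transpositions make it odd, so an even element takes two such exchanges, hence four
    3-cycles.\<close>
  define swap where
    "swap s t = transpose s t \<circ> transpose (f s) (f t) \<circ> transpose (f (f s)) (f (f t))" for s t
  have swap_fixed: "swap s t r = r" if "r \<notin> set (orb s @ orb t)" for r s t
    using that by (simp add: swap_def orb_def transpose_def)
  have inj_swap: "inj (swap s t)" for s t
    by (simp add: swap_def inj_compose)
  have swap: "f \<circ> swap s t = swap s t \<circ> f" "swap s t \<circ> swap s t = id" "swap s t s = t"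
    and swap_perm: "swap s t permutes {1..n}" "permutation (swap s t)" "\<not> evenperm (swap s t)"
    if st: "s \<in> ?M" "t \<in> ?M" "t \<notin> set (orb s)" for s t
  proof -
    have dist: "distinct (orb s @ orb t)"
      using st orb_distinct orb_disjoint by simp
    have s: "swap s t s = t" "swap s t (f s) = f t" "swap s t (f (f s)) = f (f t)"
        "swap s t t = s" "swap s t (f t) = f s" "swap s t (f (f t)) = f (f s)"
      using dist by (auto simp: swap_def orb_def transpose_def)
    show "swap s t s = t"
      by (rule s)
    have invol: "swap s t (swap s t r) = r" for r
      using s swap_fixed[of r s t] by (cases "r \<in> set (orb s @ orb t)") (auto simp: orb_def)
    then show "swap s t \<circ> swap s t = id"
      by (simp add: fun_eq_iff)
    show "f \<circ> swap s t = swap s t \<circ> f"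
    proof
      fix r
      have "f r \<in> set (orb s @ orb t) \<longleftrightarrow> r \<in> set (orb s @ orb t)"
        by (simp add: f_in_orb)
      then show "(f \<circ> swap s t) r = (swap s t \<circ> f) r"
        using s swap_fixed[of r s t] swap_fixed[of "f r" s t] fff
        by (cases "r \<in> set (orb s @ orb t)") (auto simp: orb_def)
    qed
    show "swap s t permutes {1..n}"
      unfolding swap_def using st range
      by (intro permutes_compose permutes_swap_id) (auto simp del: atLeastAtMost_iff)
    show "permutation (swap s t)" "\<not> evenperm (swap s t)"
      using dist by (auto simp: swap_def orb_def permutation_compose permutation_swap_id
          evenperm_comp evenperm_swap)
  qed
  have ab: "a \<in> ?M" "b \<in> ?M" "b \<notin> set (orb a)" and cd: "c \<in> ?M" "d \<in> ?M" "d \<notin> set (orb c)"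
    using a b c d by auto
  have disj: "set (orb a @ orb b) \<inter> set (orb c @ orb d) = {}"
    using orb_disjoint c(2) d(2) by auto
  let ?w = "swap a b \<circ> swap c d"
  have w: "?w \<in> carrier (alt_group n)"
    using swap_perm[OF ab] swap_perm[OF cd]
    by (simp add: alt_group_carrier permutes_compose evenperm_comp)
  have comm: "swap a b \<circ> swap c d = swap c d \<circ> swap a b"
  proof (intro disjoint_support_commute[where A = "set (orb a @ orb b)"] inj_swap swap_fixed)
    show "s \<notin> set (orb c @ orb d)" if "s \<in> set (orb a @ orb b)" for s
      using that disj by blast
  qed
  have "?w \<circ> ?w = swap a b \<circ> (swap c d \<circ> swap a b) \<circ> swap c d"
    by (simp only: comp_assoc)
  also have "\<dots> = (swap a b \<circ> swap a b) \<circ> (swap c d \<circ> swap c d)"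
    unfolding comm[symmetric] by (simp only: comp_assoc)
  finally have w2: "?w ^^ 2 = id"
    by (simp add: numeral_2_eq_2 swap(2)[OF ab] swap(2)[OF cd])
  have "a \<notin> set (orb c @ orb d)"
    using disj by (auto simp: orb_def)
  then have "?w a = b"
    using swap_fixed[of a c d] swap(3)[OF ab] by simp
  then have wid: "?w \<noteq> id"
    using b by (metis id_apply list.set_intros(1) orb_def)
  have "f \<circ> ?w = ?w \<circ> f"
    using swap(1)[OF ab] swap(1)[OF cd] by (metis comp_assoc)
  then have "(f, ?w) \<in> alt_adj n"
    using f w w2 wid by (intro alt_adjI[where p = 3 and q = 2]) auto
  \<comment> \<open>Twelve possibly moved points and \<open>n \<ge> 15\<close> leave three fixed
    ones.\<close>
  moreover have "card {s \<in> {1..n}. ?w s = s} \<ge> 3"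
    using card_fixed_points_ge[of "orb a @ orb b @ orb c @ orb d" ?w n] n swap_fixed
    by (auto simp: orb_def)
  then have "(?w, three_cycle 1 2 3) \<in> (alt_adj n)\<^sup>*"
    using n w w2 wid by (intro connected_if_three_fixed_points[where p = 2]) auto
  ultimately show ?thesis
    by (meson converse_rtrancl_into_rtrancl)
qed

section \<open>A commuting element of order 3 built from orbits\<close>

lemma funpow_comp_commute: "f \<circ> g = g \<circ> f \<Longrightarrow> f ((g ^^ k) a) = (g ^^ k) (f a)"
  by (induction k) (auto simp: fun_eq_iff)

lemma funpow_mult_eq_id:
  assumes "f ^^ p = id"
  shows "(f ^^ (p * k)) a = a" "(f ^^ (k * p)) a = a"
proof -
  have "f ^^ (p * k) = id"
    using assms by (simp add: id_funpow flip: funpow_mult)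
  then show "(f ^^ (p * k)) a = a" "(f ^^ (k * p)) a = a"
    by (simp_all add: mult.commute)
qed

text \<open>Commutation gives \<open>(g ^^ m) a = (x ^^ (k * m)) a\<close>. Taking for
  \<open>m\<close> a multiple of \<open>p\<close> that is 1 modulo \<open>q\<close> makes the left
  side \<open>g a\<close> and the right side \<open>a\<close>.\<close>

lemma fixed_if_commuting_coprime_orders:
  fixes p q :: nat
  assumes comm: "x \<circ> g = g \<circ> x" and x: "x ^^ p = id" and g: "g ^^ q = id"
    and cop: "coprime p q" "p \<noteq> 0" and a: "g a = (x ^^ k) a"
  shows "g a = a"
proof -
  have pow: "(g ^^ m) a = (x ^^ (k * m)) a" for m
  proof (induction m)
    case (Suc m)
    have "(g ^^ Suc m) a = g ((x ^^ (k * m)) a)"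
      using Suc by simp
    also have "\<dots> = (x ^^ (k * m)) ((x ^^ k) a)"
      using funpow_comp_commute[OF comm[symmetric]] a by simp
    also have "\<dots> = (x ^^ (k * Suc m)) a"
      unfolding mult_Suc_right add.commute[of k] funpow_add by simp
    finally show ?case .
  qed simp
  obtain s t where st: "p * s = q * t + 1"
    using bezout_nat[OF cop(2), of q] cop(1) by (auto simp: coprime_iff_gcd_eq_1)
  have "g a = g ((g ^^ (q * t)) a)"
    using funpow_mult_eq_id[OF g] by simp
  also have "\<dots> = (g ^^ (p * s)) a"
    by (simp add: st)
  also have "\<dots> = (x ^^ (p * (k * s))) a"
    unfolding pow by (simp add: ac_simps)
  also have "\<dots> = a"
    by (rule funpow_mult_eq_id[OF x])
  finally show ?thesis .
qed

text \<open>The orbits of \<open>a\<close>, \<open>y a\<close> and \<open>y (y a)\<close> under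
  \<open>x\<close> are disjoint, and \<open>w\<close> rotates them by means of \<open>y\<close>.
  Since \<open>x\<close> commutes with \<open>y\<close> and preserves each orbit, it commutes with
  \<open>w\<close>.\<close>

lemma ex_commuting_order_3:
  assumes x: "x \<in> carrier (alt_group n)" "x ^^ p = id"
    and y: "y \<in> carrier (alt_group n)" "y ^^ q = id" "y \<noteq> id"
    and comm: "x \<circ> y = y \<circ> x" and cop: "coprime p q" "p \<noteq> 0" and q: "odd q"
  obtains w where "w \<in> carrier (alt_group n)" "w ^^ 3 = id" "w \<noteq> id" "x \<circ> w = w \<circ> x"
proof -
  obtain a where a: "y a \<noteq> a"
    using y(3) by (auto simp: fun_eq_iff)
  have bij: "bij y" and inj: "inj y"
    using alt_group_bij[OF y(1)] by (auto simp: bij_is_inj)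
  define y' where "y' = Hilbert_Choice.inv y"
  have y': "y (y' s) = s" "y' (y s) = s" for s
    using bij by (auto simp: y'_def bij_is_surj surj_f_inv_f bij_is_inj)
  have yx: "y (x s) = x (y s)" for s
    using comm by (metis comp_apply)
  have y'x: "y' (x s) = x (y' s)" for s
    using yx y' by metis
  \<comment> \<open>If \<open>y\<close> squared fixed \<open>a\<close>, the odd power
    \<open>y ^^ q\<close> would send \<open>a\<close> to \<open>y a\<close>.\<close>
  have ya: "y (y a) \<noteq> a"
  proof
    assume eq: "y (y a) = a"
    have "(y ^^ (2 * m)) a = a" for m
      by (induction m) (auto simp: eq)
    moreover obtain m where "q = 2 * m + 1"
      using q by (auto elim: oddE)
    ultimately have "(y ^^ q) a = y a"
      by simp
    then show False
      using y(2) a by simp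
  qed
  \<comment> \<open>Nonnegative powers give the whole orbit, because \<open>x ^^ (p - 1)\<close>
    inverts \<open>x\<close>.\<close>
  define Orb where "Orb j = range (\<lambda>i. (x ^^ i) ((y ^^ j) a))" for j
  have yO: "y s \<in> Orb (Suc j)" if "s \<in> Orb j" for s j
    using that funpow_comp_commute[OF comm[symmetric]] by (auto simp: Orb_def)
  have y'Orb: "y' s \<in> Orb j" if "s \<in> Orb (Suc j)" for s j
    using that y' by (auto simp: Orb_def simp flip: funpow_comp_commute[OF comm[symmetric]])
  have xO: "x s \<in> Orb j \<longleftrightarrow> s \<in> Orb j" for s j
  proof
    assume "x s \<in> Orb j"
    then obtain i where "x s = (x ^^ i) ((y ^^ j) a)"
      by (auto simp: Orb_def)
    then have "(x ^^ (p - 1)) (x s) = (x ^^ (p - 1 + i)) ((y ^^ j) a)"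
      by (simp add: funpow_add)
    moreover have "(x ^^ (p - 1)) (x s) = (x ^^ p) s"
      using cop(2) by (cases p) (auto simp: funpow_swap1)
    ultimately show "s \<in> Orb j"
      using x(2) by (auto simp: Orb_def)
  next
    assume "s \<in> Orb j"
    then show "x s \<in> Orb j"
      by (auto simp: Orb_def simp flip: funpow.simps(2) comp_apply[of x])
  qed
  \<comment> \<open>If the two orbits met, \<open>y ^^ d\<close> would send \<open>b\<close> into
    its own orbit under \<open>x\<close> and hence, by coprimality, fix it. Cancelling
    \<open>y ^^ j\<close> then contradicts the choice of \<open>d\<close>.\<close>
  have disj: "s \<notin> Orb (j + d)" if s: "s \<in> Orb j" and d: "(y ^^ d) a \<noteq> a" for s j d
  proof
    assume "s \<in> Orb (j + d)"
    define b where "b = (y ^^ j) a"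
    obtain i i' where "(x ^^ i) b = (x ^^ i') ((y ^^ d) b)"
      using s \<open>s \<in> Orb (j + d)\<close> unfolding Orb_def b_def
      by (auto simp: add.commute[of j] funpow_add)
    then have "(x ^^ (i' * (p - 1))) ((x ^^ i) b) = (x ^^ (i' * (p - 1) + i')) ((y ^^ d) b)"
      by (simp add: funpow_add)
    also have "i' * (p - 1) + i' = i' * p"
      using cop(2) by (cases p) auto
    finally have "(y ^^ d) b = (x ^^ (i' * (p - 1) + i)) b"
      using funpow_mult_eq_id[OF x(2)] by (simp add: funpow_add)
    moreover have "x \<circ> y ^^ d = y ^^ d \<circ> x"
      using funpow_comp_commute[OF comm] by (auto simp: fun_eq_iff)
    moreover have "(y ^^ d) ^^ q = id"
      by (metis y(2) funpow_mult mult.commute id_funpow)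
    ultimately have "(y ^^ d) b = b"
      using fixed_if_commuting_coprime_orders[OF _ x(2) _ cop] by blast
    then have "(y ^^ j) ((y ^^ d) a) = (y ^^ j) a"
      unfolding b_def by (metis comp_apply funpow_add add.commute)
    then show False
      using d inj by (metis inj_fn injD)
  qed
  have d01: "s \<notin> Orb (Suc 0)" if "s \<in> Orb 0" for s
    using disj[OF that, of 1] a by simp
  have d12: "s \<notin> Orb (Suc (Suc 0))" if "s \<in> Orb (Suc 0)" for s
    using disj[OF that, of 1] a by simp
  have d02: "s \<notin> Orb (Suc (Suc 0))" if "s \<in> Orb 0" for s
    using disj[OF that, of 2] ya by (simp add: numeral_2_eq_2)
  \<comment> \<open>On the third orbit the inverse of \<open>y\<close> is applied twice to return to
    the first; applying \<open>y\<close> again need not lead back there.\<close>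
  define w where "w s = (if s \<in> Orb 0 \<union> Orb (Suc 0) then y s
      else if s \<in> Orb (Suc (Suc 0)) then y' (y' s) else s)" for s
  have w0: "w s = y s" if "s \<in> Orb 0" for s
    using that by (simp add: w_def)
  have w1: "w s = y s" if "s \<in> Orb (Suc 0)" for s
    using that by (simp add: w_def)
  have w2: "w s = y' (y' s)" if "s \<in> Orb (Suc (Suc 0))" for s
    using that d02 d12 by (auto simp: w_def)
  have www: "w (w (w s)) = s" for s
  proof -
    consider "s \<in> Orb 0" | "s \<in> Orb (Suc 0)" | "s \<in> Orb (Suc (Suc 0))"
      | "s \<notin> Orb 0 \<union> Orb (Suc 0) \<union> Orb (Suc (Suc 0))"
      by blast
    then show ?thesis
    proof cases
      case 1
      then have "y s \<in> Orb (Suc 0)" "y (y s) \<in> Orb (Suc (Suc 0))"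
        using yO by blast+
      with 1 show ?thesis
        by (simp add: w0 w1 w2 y')
    next
      case 2
      then have "y s \<in> Orb (Suc (Suc 0))" "y' s \<in> Orb 0"
        using yO y'Orb by blast+
      with 2 show ?thesis
        by (simp add: w0 w1 w2 y')
    next
      case 3
      then have "y' s \<in> Orb (Suc 0)" "y' (y' s) \<in> Orb 0"
        using y'Orb by blast+
      with 3 show ?thesis
        by (simp add: w0 w1 w2 y')
    next
      case 4
      then show ?thesis
        by (simp add: w_def)
    qed
  qed
  have w3: "w ^^ 3 = id"
    by (simp add: fun_eq_iff numeral_3_eq_3 www)
  have range: "s \<in> {1..n}" if "w s \<noteq> s" for s
  proof (rule ccontr)
    assume "s \<notin> {1..n}"
    then have "y s = s"
      using y(1) unfolding alt_group_carrier permutes_def by blast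
    then show False
      using that y' by (auto simp: w_def split: if_splits) (metis y')
  qed
  have "bij w"
    by (rule o_bij[of "w \<circ> w"]) (auto simp: fun_eq_iff www)
  then have "w permutes {1..n}"
    unfolding permutes_def bij_iff using range by blast
  moreover from this have "permutation w"
    by (auto simp: permutation_permutes)
  \<comment> \<open>The cube of \<open>w\<close> has the parity of \<open>w\<close>, and it is the
    identity.\<close>
  then have "evenperm w"
    using evenperm_comp[of w "w \<circ> w"] evenperm_comp[of w w] w3
    by (simp add: numeral_3_eq_3 permutation_compose)
  ultimately have "w \<in> carrier (alt_group n)"
    by (simp add: alt_group_carrier)
  moreover have "a \<in> Orb 0"
    unfolding Orb_def by (metis funpow_0 rangeI)
  then have "w \<noteq> id"
    using a w0 by (metis id_apply)
  moreover have "x \<circ> w = w \<circ> x"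
    by (auto simp: fun_eq_iff w_def xO yx y'x)
  ultimately show ?thesis
    using that w3 by blast
qed

section \<open>Connectedness of the difference graph\<close>

lemma difference_graph_vertex_connected:
  assumes n: "n \<ge> 15" and x: "x \<in> pverts (difference_graph (alt_group n))"
  shows "(x, three_cycle 1 2 3) \<in> (alt_adj n)\<^sup>*"
proof -
  interpret group "alt_group n"
    by (rule alt_group_is_group)
  have fin: "finite (carrier (alt_group n))"
    by (rule finite_subset[OF _ finite_permutations[of "{1..n}"]]) (auto simp: alt_group_carrier)
  obtain z where "(x, z) \<in> alt_adj n"
    using x by (auto simp: difference_graph_verts)
  then obtain u v and p q :: nat
    where xu: "(x, u) \<in> (alt_adj n)\<^sup>*" and pq: "prime p" "prime q" "p \<noteq> q"
      and u: "u \<in> carrier (alt_group n)" "u \<noteq> id" "u ^^ p = id"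
      and v: "v \<in> carrier (alt_group n)" "v \<noteq> id" "v ^^ q = id" and uv: "u \<circ> v = v \<circ> u"
    using difference_graph_connected_to_prime_order[OF _ fin, of x z]
    unfolding alt_group_mult alt_group_one alt_group_nat_pow by metis
  have cop: "coprime p q"
    using pq by (rule primes_coprime)
  \<comment> \<open>The first case treats \<open>u\<close> itself, the second moves on to the
    involution \<open>v\<close>. In the third, \<open>q\<close> is odd, which yields
    \<open>w\<close> of order 3, and \<open>p \<noteq> 3\<close> makes \<open>u\<close> adjacent to
    it.\<close>
  consider "p = 3" | "q = 2" | "p \<noteq> 3" "q \<noteq> 2"
    by blast
  then have "(u, three_cycle 1 2 3) \<in> (alt_adj n)\<^sup>*"
  proof cases
    case 1
    then show ?thesis
      using order_3_connected[OF n] u by simp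
  next
    case 2
    have "(u, v) \<in> alt_adj n"
      using u v uv cop by (intro alt_adjI)
    moreover have "(v, three_cycle 1 2 3) \<in> (alt_adj n)\<^sup>*"
      using involution_connected[of n v] n v 2 by simp
    ultimately show ?thesis
      by (meson converse_rtrancl_into_rtrancl)
  next
    case 3
    have "odd q" "p \<noteq> 0"
      using 3 pq primes_dvd_imp_eq[OF two_is_prime_nat, of q] by auto
    then obtain w where w: "w \<in> carrier (alt_group n)" "w ^^ 3 = id" "w \<noteq> id" "u \<circ> w = w \<circ> u"
      using ex_commuting_order_3[of u n p v q] u v uv cop by blast
    have "coprime p 3"
      using pq 3 by (intro primes_coprime) auto
    then have "(u, w) \<in> alt_adj n"
      using u w by (intro alt_adjI)
    then show ?thesis
      using order_3_connected[OF n w(1-3)] by (meson converse_rtrancl_into_rtrancl)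
  qed
  with xu show ?thesis
    by (rule rtrancl_trans)
qed

theorem theorem5p8:
  fixes n :: nat
  assumes "n \<ge> 18"
  shows "Digraph_Component.connected (with_proj (difference_graph (alt_group n)))"
proof -
  let ?D = "difference_graph (alt_group n)"
  \<comment> \<open>Connectedness is defined through the symmetric closure, which leaves this
    symmetric graph unchanged.\<close>
  have verts: "pverts (mk_symmetric (with_proj ?D)) = pverts ?D"
    and arcs: "parcs (mk_symmetric (with_proj ?D)) = alt_adj n"
    using difference_graph_sym by (auto simp: mk_symmetric_def with_proj_def)
  \<comment> \<open>Connectedness includes a nonempty vertex set; this adjacent pair provides a
    vertex.\<close>
  let ?c = "three_cycle 1 2 3" and ?t = "transpose 4 5 \<circ> transpose 6 7 :: nat \<Rightarrow> nat"
  have "(?c, ?t) \<in> alt_adj n"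
  proof (rule alt_adjI[where p = 3 and q = 2])
    show "?c \<circ> ?t = ?t \<circ> ?c"
      by (intro disjoint_support_commute[where A = "{1, 2, 3}"] inj_three_cycle
          inj_double_transposition three_cycle_fixed double_transposition_fixed) auto
    show "?c \<in> carrier (alt_group n)" "?t \<in> carrier (alt_group n)"
      by (rule alt_group_comp_transposes; use assms in simp)+
    show "?c ^^ 3 = id" "?c \<noteq> id" "?t ^^ 2 = id" "?t \<noteq> id"
      by (rule three_cycle_pow double_transposition_pow; simp)+
  qed simp
  then have "?c \<in> pverts ?D"
    by (subst difference_graph_verts) (rule exI)
  then have ne: "pverts ?D \<noteq> {}"
    by (rule ex_in_conv[THEN iffD1, OF exI])
  \<comment> \<open>Reachability asks that paths stay among the vertices, which holds because every
    endpoint of an arc is a vertex.\<close>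
  have "(u, v) \<in> rtrancl_on (pverts ?D) (alt_adj n)" if uv: "u \<in> pverts ?D" "v \<in> pverts ?D" for u v
  proof (rule rtrancl_consistent_rtrancl_on)
    show "(u, v) \<in> (alt_adj n)\<^sup>*"
      using assms uv
      by (intro rtrancl_trans[OF difference_graph_vertex_connected
            alt_adj_rtrancl_sym[OF difference_graph_vertex_connected]]) simp_all
    show "b \<in> pverts ?D" if "(a, b) \<in> alt_adj n" for a b
      by (subst difference_graph_verts) (rule exI, rule difference_graph_sym[OF that])
  qed (use uv in auto)
  then show ?thesis
    using ne unfolding connected_def strongly_connected_def reachable_def
    by (simp add: verts arcs arcs_ends_def arc_to_ends_def)
qed

end
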